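(* Let $Y$ be a forest with vertex set $\{1,\dots,n\}$, let $K$ be a finite set, and let $\mathfrak{F}_Y=(F_i)_{i=1}^n$ be a sequence of $Y$-local functions $F_i\colon K^n\to K^n$. Then all permutation SDS maps $[\mathfrak{F}_Y,\pi]$ are cycle equivalent; that is, for any two permutations $\pi,\pi'$ of the vertex set of $Y$, the maps $[\mathfrak{F}_Y,\pi]$ and $[\mathfrak{F}_Y,\pi']$ are cycle equivalent.
   Context: Graphs are finite, simple and undirected; a forest is a graph without cycles. Each vertex $v$ has a state $y_v\in K$; $\mathbf{y}=(y_1,\dots,y_n)\in K^n$ is a system state, and $\mathbf{y}[i]$ denotes the restriction of $\mathbf{y}$ to the vertex $i$ together with its neighbors in $Y$ (ordered increasingly). A $Y$-local function at $i$ is a map $F_i\colon K^n\to K^n$ of the form $F_i(y_1,\dots,y_n)=(y_1,\dots,y_{i-1},f_i(\mathbf{y}[i]),y_{i+1},\dots,y_n)$, where $f_i\colon K^{d(i)+1}\to K$ is an arbitrary function and $d(i)$ is the degree of $i$. A permutation $\pi=(\pi_1,\dots,\pi_n)$ of the vertex set is a word in which every vertex occurs exactly once, and the associated permutation SDS map is $[\mathfrak{F}_Y,\pi]=F_{\pi_n}\circ F_{\pi_{n-1}}\circ\cdots\circ F_{\pi_1}$. For a map $\phi$ of a finite set to itself, $\mathrm{Per}(\phi)$ is its set of periodic points. Two self-maps $\phi,\psi$ of finite sets are cycle equivalent if there is a bijection $h\colon \mathrm{Per}(\phi)\to\mathrm{Per}(\psi)$ with $\psi|_{\mathrm{Per}(\psi)}\circ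 h=h\circ\phi|_{\mathrm{Per}(\phi)}$. *)

theory Defs
  imports "Graph_Theory.Pair_Digraph" "HOL-Combinatorics.Multiset_Permutations"
    "HOL-Library.FuncSet"
begin

text \<open>
  A finite simple undirected graph is a \<^locale>\<open>pair_graph\<close>: finite, loopfree, and with both
  orientations of every edge present as arcs. In such a digraph every edge gives a directed cycle
  of length two (there and back), which is not a cycle of the undirected graph; hence the
  bound on the length below.
\<close>

definition undirected_forest :: "'a pair_pre_digraph \<Rightarrow> bool" where
  "undirected_forest Y \<longleftrightarrow>
     pair_graph Y \<and> \<not> (\<exists>p. pre_digraph.cycle (with_proj Y) p \<and> 3 \<le> length p)"

definition neighbors :: "'a pair_pre_digraph \<Rightarrow> 'a \<Rightarrow> 'a set" where
  "neighbors Y i = {j. (i, j) \<in> parcs Y}"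

definition degree :: "'a pair_pre_digraph \<Rightarrow> 'a \<Rightarrow> nat" where
  "degree Y i = card (neighbors Y i)"

text \<open>
  System states, i.e. the elements of $K^n$, are extensional functions on \<open>{1..n}\<close>;
  tuples in $K^{d(i)+1}$ are lists.
\<close>

definition states :: "nat \<Rightarrow> 'k set \<Rightarrow> (nat \<Rightarrow> 'k) set" where
  "states n K = {1..n} \<rightarrow>\<^sub>E K"

definition local_state :: "nat pair_pre_digraph \<Rightarrow> (nat \<Rightarrow> 'k) \<Rightarrow> nat \<Rightarrow> 'k list" where
  "local_state Y y i = map y (sorted_list_of_set (insert i (neighbors Y i)))"

text \<open>The values of \<open>F\<close> outside \<^term>\<open>states n K\<close> are irrelevant.\<close>

definition local_function ::
  "nat pair_pre_digraph \<Rightarrow> nat \<Rightarrow> 'k set \<Rightarrow> nat \<Rightarrow> ((nat \<Rightarrow> 'k) \<Rightarrow> (nat \<Rightarrow> 'k)) \<Rightarrow> bool" where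
  "local_function Y n K i F \<longleftrightarrow>
     (\<exists>f. f \<in> {xs. set xs \<subseteq> K \<and> length xs = degree Y i + 1} \<rightarrow> K \<and>
          (\<forall>y \<in> states n K. F y = y(i := f (local_state Y y i))))"

text \<open>The first letter of the word \<open>\<pi>\<close> is applied first.\<close>

definition sds_map :: "(nat \<Rightarrow> 's \<Rightarrow> 's) \<Rightarrow> nat list \<Rightarrow> 's \<Rightarrow> 's" where
  "sds_map F \<pi> = fold F \<pi>"

text \<open>
  A self-map of a set \<open>A\<close> is a HOL function together with its carrier \<open>A\<close>.
\<close>

definition Per :: "'a set \<Rightarrow> ('a \<Rightarrow> 'a) \<Rightarrow> 'a set" where
  "Per A \<phi> = {x \<in> A. \<exists>m>0. (\<phi> ^^ m) x = x}"

definition cycle_equivalent ::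
  "'a set \<Rightarrow> ('a \<Rightarrow> 'a) \<Rightarrow> 'b set \<Rightarrow> ('b \<Rightarrow> 'b) \<Rightarrow> bool" where
  "cycle_equivalent A \<phi> B \<psi> \<longleftrightarrow>
     (\<exists>h. bij_betw h (Per A \<phi>) (Per B \<psi>) \<and> (\<forall>x \<in> Per A \<phi>. \<psi> (h x) = h (\<phi> x)))"

end

theory Submission
  imports Defs
begin

text \<open>
  Rotating a word \<open>a # w\<close> to \<open>w @ [a]\<close> replaces a composition \<open>B \<circ> A\<close> by \<open>A \<circ> B\<close>, which is cycle
  equivalent to it by way of \<open>A\<close>, and swapping consecutive non-adjacent letters does not change the
  map at all. In a forest these two moves connect all permutations: remove a leaf \<open>v\<close> with neighbour
  \<open>a\<close> and connect the shorter words by induction. When the letter \<open>v\<close> is put back in front, a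
  rotation moving a letter \<open>b\<close> to the end has to carry \<open>b\<close> past \<open>v\<close>; if \<open>b = a\<close>, rotate \<open>v\<close> to
  the end first and then move it back past the remaining letters, all of which commute with \<open>v\<close>.
\<close>

section \<open>Words modulo rotation and partial commutation\<close>

text \<open>With \<open>I\<close> as non-adjacency in a graph, words listing every vertex once
  modulo \<open>swap\<close> are the acyclic orientations, and \<open>rotate\<close> turns a source
  into a sink.\<close>

inductive torically_equivalent :: "('a \<Rightarrow> 'a \<Rightarrow> bool) \<Rightarrow> 'a list \<Rightarrow> 'a list \<Rightarrow> bool"
  for I :: "'a \<Rightarrow> 'a \<Rightarrow> bool" where
  refl: "torically_equivalent I u u"
| trans: "torically_equivalent I u v \<Longrightarrow> torically_equivalent I v w \<Longrightarrow> torically_equivalent I u w"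
| swap: "I a b \<Longrightarrow> torically_equivalent I (u @ a # b # w) (u @ b # a # w)"
| rotate: "torically_equivalent I (a # u) (u @ [a])"

lemma torically_equivalent_append_commute: "torically_equivalent I (u @ v) (v @ u)"
proof (induction u arbitrary: v)
  case Nil
  show ?case by (simp add: refl)
next
  case (Cons a u)
  have "torically_equivalent I (a # u @ v) (u @ v @ [a])"
    using rotate[of I a "u @ v"] by simp
  with Cons.IH[of "v @ [a]"] show ?case
    using trans by fastforce
qed

lemma torically_equivalent_mset: "torically_equivalent I u w \<Longrightarrow> mset u = mset w"
  by (induction rule: torically_equivalent.induct) simp_all

lemma torically_equivalent_move_back:
  assumes "\<forall>b \<in> set u. I b v"
  shows "torically_equivalent I (p @ u @ v # w) (p @ v # u @ w)"
  using assms
proof (induction u arbitrary: p)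
  case Nil
  show ?case by (simp add: refl)
next
  case (Cons b u)
  then have "torically_equivalent I (p @ b # u @ v # w) (p @ b # v # u @ w)"
    using Cons.IH[of "p @ [b]"] by simp
  moreover have "torically_equivalent I (p @ b # v # u @ w) (p @ v # b # u @ w)"
    using Cons.prems by (simp add: swap)
  ultimately show ?case
    using trans by fastforce
qed

text \<open>Lifts a chain of moves between words without the leaf \<open>v\<close> to words with
  \<open>v\<close> in front. Swaps lift unchanged; only a rotation must get its letter past
  \<open>v\<close>. Both hypotheses on \<open>u\<close> pass to intermediate words because moves
  preserve the multiset of letters.\<close>

lemma torically_equivalent_Cons:
  assumes "torically_equivalent I u w" and "distinct u"
    and "\<forall>b \<in> set u. b \<noteq> a \<longrightarrow> I v b \<and> I b v"
  shows "torically_equivalent I (v # u) (v # w)"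
  using assms
proof (induction rule: torically_equivalent.induct)
  case (refl u)
  show ?case by (rule torically_equivalent.refl)
next
  case (trans u t w)
  have "mset u = mset t"
    using trans.hyps(1) by (rule torically_equivalent_mset)
  then have "distinct t" "set t = set u"
    using trans.prems(1) by (metis mset_eq_imp_distinct_iff, metis mset_eq_setD)
  with trans show ?case
    by (metis torically_equivalent.trans)
next
  case (swap b c u w)
  then show ?case
    using torically_equivalent.swap[of I b c "v # u" w] by simp
next
  case (rotate b u)
  show ?case
  proof (cases "b = a")
    case True
    \<comment> \<open>Since \<open>b # u\<close> is distinct, \<open>a\<close> does not occur again
      in \<open>u\<close>, so \<open>v\<close> can cross all of \<open>u\<close>.\<close>
    have "\<forall>c \<in> set u. I c v"
      using rotate.prems True by auto
    then have "torically_equivalent I (b # u @ [v]) (b # v # u)"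
      using torically_equivalent_move_back[of u I v "[b]" "[]"] by simp
    moreover have "torically_equivalent I (v # b # u) (b # u @ [v])"
      using torically_equivalent.rotate[of I v "b # u"] by simp
    moreover have "torically_equivalent I (b # v # u) (v # u @ [b])"
      using torically_equivalent.rotate[of I b "v # u"] by simp
    ultimately show ?thesis
      using torically_equivalent.trans by metis
  next
    case False
    then have "torically_equivalent I (v # b # u) (b # v # u)"
      using rotate.prems torically_equivalent.swap[of I v b "[]" u] by simp
    moreover have "torically_equivalent I (b # v # u) (v # u @ [b])"
      using torically_equivalent.rotate[of I b "v # u"] by simp
    ultimately show ?thesis
      using torically_equivalent.trans by metis
  qed
qed

text \<open>Asking for a leaf in every nonempty subset makes the hypothesis inherited by
  \<open>V - {v}\<close>, so induction on \<open>V\<close> goes through. For an isolated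
  \<open>v\<close>, any \<open>a\<close> will do.\<close>

lemma torically_equivalent_permutations:
  assumes "finite V"
    and "\<And>S. S \<subseteq> V \<Longrightarrow> S \<noteq> {} \<Longrightarrow> \<exists>v \<in> S. \<exists>a. \<forall>b \<in> S - {v, a}. I v b \<and> I b v"
    and "u \<in> permutations_of_set V" and "w \<in> permutations_of_set V"
  shows "torically_equivalent I u w"
  using assms
proof (induction V arbitrary: u w rule: finite_psubset_induct)
  case (psubset V)
  show ?case
  proof (cases "V = {}")
    case True
    then show ?thesis
      using psubset.prems by (simp add: refl)
  next
    case False
    then obtain v a where v: "v \<in> V" and leaf: "\<forall>b \<in> V - {v, a}. I v b \<and> I b v"
      using psubset.prems(1)[of V] by blast
    \<comment> \<open>The remaining word is \<open>r @ q\<close>, not \<open>q @ r\<close>: rotating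
      \<open>v\<close> to the front of \<open>q @ v # r\<close> leaves the tail in this
      order.\<close>
    have split: "\<exists>q r. t = q @ v # r \<and> r @ q \<in> permutations_of_set (V - {v})"
      if "t \<in> permutations_of_set V" for t
    proof -
      have t: "set t = V" "distinct t"
        using that by (simp_all add: permutations_of_set_def)
      then obtain q r where "t = q @ v # r"
        using v by (metis split_list)
      with t show ?thesis
        by (fastforce simp: permutations_of_set_def)
    qed
    obtain q r where u: "u = q @ v # r" and qr: "r @ q \<in> permutations_of_set (V - {v})"
      using split[OF psubset.prems(2)] by blast
    obtain q' r' where w: "w = q' @ v # r'" and qr': "r' @ q' \<in> permutations_of_set (V - {v})"
      using split[OF psubset.prems(3)] by blast
    have "torically_equivalent I (r @ q) (r' @ q')"
      using v qr qr' by (intro psubset.IH[of "V - {v}"] psubset.prems(1)) auto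
    moreover have "distinct (r @ q)" "\<forall>b \<in> set (r @ q). b \<noteq> a \<longrightarrow> I v b \<and> I b v"
      using qr leaf by (auto simp: permutations_of_set_def)
    ultimately have "torically_equivalent I (v # r @ q) (v # r' @ q')"
      by (rule torically_equivalent_Cons)
    moreover have "torically_equivalent I u (v # r @ q)"
      using torically_equivalent_append_commute[of I q "v # r"] u by simp
    moreover have "torically_equivalent I (v # r' @ q') w"
      using torically_equivalent_append_commute[of I "v # r'" q'] w by simp
    ultimately show ?thesis
      using trans by metis
  qed
qed

section \<open>Leaves of forests\<close>

text \<open>The endpoint of a closed walk is listed twice among its vertices, and
  \<open>cycle\<close> drops the first occurrence; hence injectivity on the half-open
  interval.\<close>

lemma cycle_map_upt:
  assumes "pair_wf_digraph Y" and "0 < m" and "x (i + m) = x i" and "inj_on x {i<..i + m}"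
    and "\<And>k. (x k, x (Suc k)) \<in> parcs Y"
  shows "pre_digraph.cycle (with_proj Y) (map (\<lambda>k. (x k, x (Suc k))) [i..<i + m])"
proof -
  interpret pair_wf_digraph Y by fact
  \<comment> \<open>The induction lowers the starting index, because \<open>pawalk_verts\<close> and
    \<open>pcas\<close> recurse on the first arc.\<close>
  have verts: "pawalk_verts (x i) (map (\<lambda>k. (x k, x (Suc k))) [i..<j]) = map x [i..<Suc j]"
    if "i \<le> j" for i j
    using that by (induction rule: inc_induct) (simp_all add: upt_conv_Cons del: upt_Suc)
  have cas: "pcas (x i) (map (\<lambda>k. (x k, x (Suc k))) [i..<j]) (x j)" if "i \<le> j" for i j
    using that by (induction rule: inc_induct) (simp_all add: upt_conv_Cons)
  have "awalk (x i) (map (\<lambda>k. (x k, x (Suc k))) [i..<i + m]) (x i)"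
    using cas[of i "i + m"] assms(3,5) in_arcsD1[OF assms(5)] by (auto simp: awalk_def)
  moreover have "tl (map x [i..<Suc (i + m)]) = map x [Suc i..<Suc (i + m)]"
    by (simp add: upt_conv_Cons del: upt_Suc)
  moreover have "{Suc i..<Suc (i + m)} = {i<..i + m}"
    by auto
  ultimately show ?thesis
    using assms(2,4) by (auto simp: cycle_def verts distinct_map simp del: upt_Suc)
qed

text \<open>Otherwise a walk inside \<open>S\<close> can always continue without turning back. By
  finiteness it revisits a vertex, and its first return closes a cycle of length at least 3.\<close>

lemma undirected_forest_leaf:
  assumes "undirected_forest Y" and "S \<subseteq> pverts Y" and "S \<noteq> {}"
  shows "\<exists>v \<in> S. \<exists>a. \<forall>b \<in> S - {v, a}. (v, b) \<notin> parcs Y"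
proof (rule ccontr)
  interpret pair_graph Y
    using assms(1) by (simp add: undirected_forest_def)
  assume "\<not> ?thesis"
  then have "\<forall>v \<in> S. \<forall>a. \<exists>b. b \<in> S \<and> b \<noteq> a \<and> (v, b) \<in> parcs Y"
    by blast
  then obtain f where f: "\<And>v a. v \<in> S \<Longrightarrow> f v a \<in> S \<and> f v a \<noteq> a \<and> (v, f v a) \<in> parcs Y"
    by metis
  obtain v\<^sub>0 where v\<^sub>0: "v\<^sub>0 \<in> S"
    using assms(3) by blast
  \<comment> \<open>A state of the walk is the pair of previous and current vertex; \<open>f\<close>
    avoids the previous one. At the start there is none, and \<open>v\<^sub>0\<close> itself serves
    as a dummy.\<close>
  define z where "z = rec_nat (v\<^sub>0, f v\<^sub>0 v\<^sub>0) (\<lambda>_ (a, v). (v, f v a))"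
  define x where "x k = fst (z k)" for k
  have z_Suc: "z (Suc k) = (snd (z k), f (snd (z k)) (fst (z k)))" for k
    by (simp add: z_def case_prod_beta)
  have z: "fst (z k) \<in> S \<and> snd (z k) \<in> S \<and> z k \<in> parcs Y" for k
  proof (induction k)
    case 0
    show ?case using v\<^sub>0 f by (simp add: z_def)
  next
    case (Suc k)
    then show ?case using f by (simp add: z_Suc)
  qed
  have arc: "(x k, x (Suc k)) \<in> parcs Y" for k
    using z[of k] by (simp add: x_def z_Suc)
  have no_return: "x (Suc (Suc k)) \<noteq> x k" for k
    using f z[of k] by (simp add: x_def z_Suc)
  have "range x \<subseteq> pverts Y"
    using z assms(2) by (auto simp: x_def)
  then have "\<not> inj x"
    using pair_finite_verts finite_subset infinite_UNIV_nat by (metis finite_imageD)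
  then have ex: "\<exists>j. \<exists>i<j. x i = x j"
    by (metis injI linorder_neqE_nat)
  define j where "j = (LEAST j. \<exists>i<j. x i = x j)"
  obtain i where i: "i < j" "x i = x j"
    using LeastI_ex[OF ex] unfolding j_def by blast
  have minimal: "x a \<noteq> x b" if "a < b" "b < j" for a b
    using not_less_Least that unfolding j_def by blast
  \<comment> \<open>Length 1 would be a loop and length 2 a step straight back.\<close>
  have "j \<noteq> Suc i" "j \<noteq> Suc (Suc i)"
    using i arc[of i] no_return[of i] no_loops' by auto
  then have "i + 3 \<le> j"
    using i(1) by linarith
  then obtain m where m: "j = i + m" "3 \<le> m"
    by (metis add_diff_inverse_nat add_le_imp_le_diff add.commute i(1) less_imp_not_less)
  \<comment> \<open>For \<open>b = j\<close>, a coincidence with \<open>x j = x i\<close> would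
    already repeat \<open>x i\<close> at \<open>a < j\<close>, against the minimality of
    \<open>j\<close>.\<close>
  have "x a \<noteq> x b" if "i < a" "a < b" "b \<le> j" for a b
    using minimal[of a b] minimal[of i a] i that by (cases "b = j") auto
  then have "inj_on x {i<..i + m}"
    unfolding m(1) by (intro linorder_inj_onI') auto
  then have "pre_digraph.cycle (with_proj Y) (map (\<lambda>k. (x k, x (Suc k))) [i..<i + m])"
    using m i arc by (intro cycle_map_upt pair_wf_digraph) auto
  then show False
    using assms(1) m(2) by (auto simp: undirected_forest_def)
qed

section \<open>Cycle equivalence\<close>

lemma cycle_equivalent_refl: "cycle_equivalent A \<phi> A \<phi>"
  unfolding cycle_equivalent_def by (rule exI[of _ id]) simp

lemma cycle_equivalent_trans:
  assumes "cycle_equivalent A \<phi> B \<psi>" and "cycle_equivalent B \<psi> C \<chi>"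
  shows "cycle_equivalent A \<phi> C \<chi>"
proof -
  obtain g h where g: "bij_betw g (Per A \<phi>) (Per B \<psi>)" "\<forall>x \<in> Per A \<phi>. \<psi> (g x) = g (\<phi> x)"
    and h: "bij_betw h (Per B \<psi>) (Per C \<chi>)" "\<forall>x \<in> Per B \<psi>. \<chi> (h x) = h (\<psi> x)"
    using assms unfolding cycle_equivalent_def by blast
  have "\<forall>x \<in> Per A \<phi>. \<chi> (h (g x)) = h (g (\<phi> x))"
    using g h by (simp add: bij_betwE)
  then show ?thesis
    using bij_betw_trans[OF g(1) h(1)] unfolding cycle_equivalent_def comp_def by blast
qed

lemma cycle_equivalent_cong:
  assumes "\<And>x. x \<in> A \<Longrightarrow> \<phi> x = \<psi> x" and "\<phi> \<in> A \<rightarrow> A"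
  shows "cycle_equivalent A \<phi> A \<psi>"
proof -
  have "(\<phi> ^^ m) x = (\<psi> ^^ m) x \<and> (\<phi> ^^ m) x \<in> A" if "x \<in> A" for m x
  proof (induction m)
    case 0
    show ?case using that by simp
  next
    case (Suc m)
    then show ?case
      using assms(1)[of "(\<phi> ^^ m) x"] funcset_mem[OF assms(2), of "(\<phi> ^^ m) x"] by auto
  qed
  then have "Per A \<phi> = Per A \<psi>"
    by (auto simp: Per_def)
  then show ?thesis
    using assms(1) unfolding cycle_equivalent_def
    by (intro exI[of _ id]) (auto simp: Per_def)
qed

text \<open>The bijection is \<open>f\<close> itself: on periodic points, going once around the
  orbit undoes it.\<close>

lemma cycle_equivalent_comp_commute:
  assumes "f \<in> A \<rightarrow> B" and "g \<in> B \<rightarrow> A"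
  shows "cycle_equivalent A (g \<circ> f) B (f \<circ> g)"
proof -
  have f_iter: "f (((g \<circ> f) ^^ m) x) = ((f \<circ> g) ^^ m) (f x)" for m x
    by (induction m) simp_all
  have g_iter: "g (((f \<circ> g) ^^ m) y) = ((g \<circ> f) ^^ m) (g y)" for m y
    by (induction m) simp_all
  have f_Per: "f x \<in> Per B (f \<circ> g)" if "x \<in> Per A (g \<circ> f)" for x
    using that assms(1) f_iter unfolding Per_def by (smt (verit) PiE mem_Collect_eq)
  have g_Per: "g y \<in> Per A (g \<circ> f)" if "y \<in> Per B (f \<circ> g)" for y
    using that assms(2) g_iter unfolding Per_def by (smt (verit) PiE mem_Collect_eq)
  have gf_Per: "g (f x) \<in> Per A (g \<circ> f)" if "x \<in> Per A (g \<circ> f)" for x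
    using that f_Per g_Per by blast
  have "inj_on f (Per A (g \<circ> f))"
  proof (rule inj_onI)
    fix x y
    assume xy: "x \<in> Per A (g \<circ> f)" "y \<in> Per A (g \<circ> f)" "f x = f y"
    have fixpoint: "(\<phi> ^^ (k * l)) z = z" if "(\<phi> ^^ k) z = z" for \<phi> :: "'a \<Rightarrow> 'a" and k l z
      using that by (induction l) (simp_all add: funpow_add)
    from xy obtain k l where kl: "k > 0" "((g \<circ> f) ^^ k) x = x" "l > 0" "((g \<circ> f) ^^ l) y = y"
      by (auto simp: Per_def)
    \<comment> \<open>With a common period, both points are the same positive power of
      \<open>g \<circ> f\<close> applied to them, and such a power depends only on the common value
      \<open>f x = f y\<close>.\<close>
    have "((g \<circ> f) ^^ (k * l)) x = x" "((g \<circ> f) ^^ (l * k)) y = y"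
      using kl fixpoint by (metis, metis)
    moreover have "((g \<circ> f) ^^ (Suc m)) x = ((g \<circ> f) ^^ (Suc m)) y" for m
      using xy(3) by (simp only: funpow_Suc_right comp_apply)
    moreover obtain m where "k * l = Suc m"
      using kl by (metis gr0_implies_Suc nat_0_less_mult_iff)
    ultimately show "x = y"
      by (metis mult.commute)
  qed
  moreover have "y \<in> f ` Per A (g \<circ> f)" if y: "y \<in> Per B (f \<circ> g)" for y
  proof -
    obtain m where "((f \<circ> g) ^^ Suc m) y = y"
      using y by (auto simp: Per_def gr0_conv_Suc)
    \<comment> \<open>One period of \<open>y\<close> starts with \<open>g\<close> and ends with
      \<open>f\<close>; stopping before the last \<open>f\<close> gives the preimage.\<close>
    then have "y = f (((g \<circ> f) ^^ m) (g y))"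
      using g_iter[of m y] by simp
    moreover have "((g \<circ> f) ^^ m) (g y) \<in> Per A (g \<circ> f)"
      using g_Per[OF y] gf_Per by (induction m) auto
    ultimately show ?thesis by blast
  qed
  ultimately have "bij_betw f (Per A (g \<circ> f)) (Per B (f \<circ> g))"
    using f_Per unfolding bij_betw_def by blast
  then show ?thesis
    unfolding cycle_equivalent_def by (intro exI[of _ f]) simp
qed

section \<open>Sequential dynamical systems\<close>

lemma sds_map_funcset:
  assumes "\<And>i. i \<in> V \<Longrightarrow> F i \<in> A \<rightarrow> A" and "set \<pi> \<subseteq> V"
  shows "sds_map F \<pi> \<in> A \<rightarrow> A"
  using assms(2)
proof (induction \<pi>)
  case Nil
  show ?case by (simp add: sds_map_def)
next
  case (Cons i \<pi>)
  then show ?case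
    using assms(1)[of i] by (auto simp: sds_map_def Pi_iff)
qed

lemma torically_equivalent_imp_cycle_equivalent:
  assumes "torically_equivalent I \<pi> \<pi>'" and "set \<pi> \<subseteq> V"
    and F: "\<And>i. i \<in> V \<Longrightarrow> F i \<in> A \<rightarrow> A"
    and commute: "\<And>i j y. I i j \<Longrightarrow> i \<in> V \<Longrightarrow> j \<in> V \<Longrightarrow> y \<in> A \<Longrightarrow> F j (F i y) = F i (F j y)"
  shows "cycle_equivalent A (sds_map F \<pi>) A (sds_map F \<pi>')"
  using assms(1,2)
proof (induction rule: torically_equivalent.induct)
  case (refl u)
  show ?case by (rule cycle_equivalent_refl)
next
  case (trans u t w)
  have "set t = set u"
    using torically_equivalent_mset[OF trans.hyps(1)] by (metis mset_eq_setD)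
  then show ?case
    using trans by (metis cycle_equivalent_trans)
next
  case (swap i j u w)
  have "sds_map F u y \<in> A" if "y \<in> A" for y
    using sds_map_funcset[where F = F and A = A and V = V and \<pi> = u, OF F] swap.prems that by auto
  then have "sds_map F (u @ i # j # w) y = sds_map F (u @ j # i # w) y" if "y \<in> A" for y
    using commute[OF swap.hyps] swap.prems that by (simp add: sds_map_def)
  then show ?case
    using swap.prems sds_map_funcset[where F = F and A = A, OF F] by (intro cycle_equivalent_cong) auto
next
  \<comment> \<open>The two words give \<open>sds_map F u \<circ> F i\<close> and
    \<open>F i \<circ> sds_map F u\<close>.\<close>
  case (rotate i u)
  then have "F i \<in> A \<rightarrow> A" "sds_map F u \<in> A \<rightarrow> A"
    using F sds_map_funcset[where F = F and A = A, OF F] by auto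
  from cycle_equivalent_comp_commute[OF this] show ?case
    by (simp add: sds_map_def comp_def)
qed

text \<open>Looplessness gives the local state length exactly \<open>degree Y i + 1\<close>, so it
  lies in the domain of \<open>f\<close>; as \<open>i\<close> lies in \<open>{1..n}\<close>, the
  update stays extensional.\<close>

lemma local_function_funcset:
  assumes "pair_graph Y" and "pverts Y = {1..n}" and "i \<in> {1..n}" and "local_function Y n K i F"
  shows "F \<in> states n K \<rightarrow> states n K"
proof
  interpret pair_graph Y by fact
  fix y
  assume y: "y \<in> states n K"
  obtain f where f: "f \<in> {xs. set xs \<subseteq> K \<and> length xs = degree Y i + 1} \<rightarrow> K"
    and F: "\<forall>y \<in> states n K. F y = y(i := f (local_state Y y i))"
    using assms(4) unfolding local_function_def by blast
  have nbrs: "neighbors Y i \<subseteq> {1..n}" "i \<notin> neighbors Y i"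
    using in_arcsD2 assms(2) no_loops'[of i i] by (auto simp: neighbors_def)
  then have fin: "finite (neighbors Y i)"
    by (simp add: finite_subset)
  have "length (local_state Y y i) = degree Y i + 1"
    using fin nbrs(2) by (simp add: local_state_def degree_def)
  moreover have "set (local_state Y y i) \<subseteq> K"
  proof -
    have "set (sorted_list_of_set (insert i (neighbors Y i))) = insert i (neighbors Y i)"
      using fin by (intro set_sorted_list_of_set) simp
    then show ?thesis
      using nbrs(1) y assms(3) unfolding local_state_def states_def by fastforce
  qed
  ultimately have "f (local_state Y y i) \<in> K"
    using f by blast
  then show "F y \<in> states n K"
    using F y assms(3) by (auto simp: states_def PiE_iff extensional_def)
qed

text \<open>Neither function reads the coordinate that the other one writes.\<close>

lemma local_function_commute:
  assumes "finite (parcs Y)" and "(i, j) \<notin> parcs Y" and "(j, i) \<notin> parcs Y"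
    and "local_function Y n K i F" and "local_function Y n K j G"
    and "F \<in> states n K \<rightarrow> states n K" and "G \<in> states n K \<rightarrow> states n K"
    and "i \<noteq> j" and "y \<in> states n K"
  shows "G (F y) = F (G y)"
proof -
  obtain f where f: "\<forall>y \<in> states n K. F y = y(i := f (local_state Y y i))"
    using assms(4) unfolding local_function_def by blast
  obtain g where g: "\<forall>y \<in> states n K. G y = y(j := g (local_state Y y j))"
    using assms(5) unfolding local_function_def by blast
  have fin: "finite (neighbors Y k)" for k
    using finite_imageI[OF assms(1), of snd] by (rule finite_subset[rotated]) (force simp: neighbors_def)
  have set_local: "set (sorted_list_of_set (insert k (neighbors Y k))) = insert k (neighbors Y k)" for k
    using fin by (intro set_sorted_list_of_set) simp
  have "local_state Y (y(i := a)) j = local_state Y y j" for a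
    unfolding local_state_def by (rule map_cong) (use assms(3,8) set_local in \<open>auto simp: neighbors_def\<close>)
  moreover have "local_state Y (y(j := a)) i = local_state Y y i" for a
    unfolding local_state_def by (rule map_cong) (use assms(2,8) set_local in \<open>auto simp: neighbors_def\<close>)
  moreover have "F y \<in> states n K" "G y \<in> states n K"
    using assms(6,7,9) by auto
  ultimately show ?thesis
    using f g assms(8,9) by (simp add: fun_upd_twist)
qed

theorem proposition5p4:
  fixes Y :: "nat pair_pre_digraph" and n :: nat and K :: "'k set"
    and F :: "nat \<Rightarrow> (nat \<Rightarrow> 'k) \<Rightarrow> (nat \<Rightarrow> 'k)"
  assumes "undirected_forest Y" and "pverts Y = {1..n}"
    and "finite K"
    and "\<forall>i \<in> {1..n}. local_function Y n K i (F i)"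
  shows "\<forall>\<pi> \<in> permutations_of_set {1..n}. \<forall>\<pi>' \<in> permutations_of_set {1..n}.
           cycle_equivalent (states n K) (sds_map F \<pi>) (states n K) (sds_map F \<pi>')"
proof (intro ballI)
  fix \<pi> \<pi>'
  assume \<pi>: "\<pi> \<in> permutations_of_set {1..n}" and \<pi>': "\<pi>' \<in> permutations_of_set {1..n}"
  have "pair_graph Y"
    using assms(1) by (simp add: undirected_forest_def)
  then interpret pair_graph Y .
  define I where "I i j \<longleftrightarrow> (i, j) \<notin> parcs Y \<and> (j, i) \<notin> parcs Y" for i j
  have F: "F i \<in> states n K \<rightarrow> states n K" if "i \<in> {1..n}" for i
    using local_function_funcset \<open>pair_graph Y\<close> assms(2,4) that by blast
  \<comment> \<open>The leaf lemma excludes arcs leaving \<open>v\<close>; symmetry of the arcs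
    excludes those entering it.\<close>
  have "\<exists>v \<in> S. \<exists>a. \<forall>b \<in> S - {v, a}. I v b \<and> I b v" if "S \<subseteq> {1..n}" "S \<noteq> {}" for S
    using undirected_forest_leaf[OF assms(1), of S] that assms(2) arcs_symmetric
    unfolding I_def by metis
  then have "torically_equivalent I \<pi> \<pi>'"
    using \<pi> \<pi>' by (intro torically_equivalent_permutations[of "{1..n}"]) auto
  \<comment> \<open>Without loops \<open>I i i\<close> holds as well, so the trivial case
    \<open>i = j\<close> is treated separately.\<close>
  moreover have "F j (F i y) = F i (F j y)"
    if "I i j" "i \<in> {1..n}" "j \<in> {1..n}" "y \<in> states n K" for i j y
    using local_function_commute[of Y i j n K "F i" "F j" y] F that assms(4) pair_finite_arcs
    unfolding I_def by (cases "i = j") auto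
  moreover have "set \<pi> \<subseteq> {1..n}"
    using \<pi> by (simp add: permutations_of_set_def)
  ultimately show "cycle_equivalent (states n K) (sds_map F \<pi>) (states n K) (sds_map F \<pi>')"
    using F by (intro torically_equivalent_imp_cycle_equivalent[where V = "{1..n}"])
qed

end
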